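(* Let $t\ge 1$ be an integer and, for each $i\in\{1,\ldots,t\}$, let $\{A^i_n\}_{n=0}^\infty$ be a sequence of positive real numbers (not necessarily periodic). Suppose there exists $j\in\{1,\ldots,t+1\}$ such that for all $i\in\{1,\ldots,t\}$ $$\sup\{A^i_{(t+1)n+(t+1)+j}:\ n=0,1,\ldots\}\;<\;\inf\{A^{t+1-i}_{(t+1)n+(t+1-i)+j}:\ n=0,1,\ldots\}.$$ Then every positive solution $\{x_n\}_{n=-t}^\infty$ of $$x_n=\max\left\{\frac{A^1_{n-1}}{x_{n-1}},\frac{A^2_{n-1}}{x_{n-2}},\ldots,\frac{A^t_{n-1}}{x_{n-t}}\right\},\qquad n=1,2,\ldots,$$ is unbounded.
   Context: A positive solution is a sequence $\{x_n\}_{n=-t}^{\infty}$ of positive real numbers (with arbitrary positive initial values) satisfying the recurrence for every $n\ge 1$. A positive sequence is bounded if there is a constant $M>0$ with $0<x_n\le M$ for all $n\ge -t$, and unbounded otherwise. The supremum in the hypothesis is a priori allowed to be $+\infty$; the strict inequality forces it to be finite. *)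

theory Defs
  imports Complex_Main "HOL-Library.Extended_Real"
begin

text \<open>
  A sequence $(x_n)_{n \ge -t}$ is a function on the integers of which only the values
  at indices $n \ge -t$ matter; the coefficient $A^i_n$ is \<open>A i n\<close>, where only the
  values for $1 \le i \le t$ matter.
\<close>

definition positive_solution :: "nat \<Rightarrow> (nat \<Rightarrow> nat \<Rightarrow> real) \<Rightarrow> (int \<Rightarrow> real) \<Rightarrow> bool" where
  "positive_solution t A x \<longleftrightarrow>
     (\<forall>n \<ge> - int t. x n > 0) \<and>
     (\<forall>n::nat. n \<ge> 1 \<longrightarrow> x (int n) = Max ((\<lambda>i. A i (n - 1) / x (int n - int i)) ` {1..t}))"

definition bounded_seq :: "nat \<Rightarrow> (int \<Rightarrow> real) \<Rightarrow> bool" where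
  "bounded_seq t x \<longleftrightarrow> (\<exists>M>0. \<forall>n \<ge> - int t. 0 < x n \<and> x n \<le> M)"

end

theory Submission
  imports Defs
begin

text \<open>
  The recurrence says that every product \<open>x n * x (n - i)\<close> with \<open>1 \<le> i \<le> t\<close> is at least
  \<open>A i (n - 1)\<close>, and that equality holds for at least one \<open>i\<close>. Take \<open>i\<close> with equality at the
  index \<open>N = k + (t + 1)\<close>. The step from \<open>N - i\<close> down to \<open>k\<close> has length \<open>t + 1 - i\<close>, which again
  lies between \<open>1\<close> and \<open>t\<close>, so the inequality at \<open>N - i\<close> involves \<open>x k\<close>. Dividing one relation by
  the other eliminates \<open>x (N - i)\<close> and gives
  \<open>x N / x k \<le> A i (N - 1) / A (t + 1 - i) (N - i - 1)\<close>
  (lemma \<open>positive_solution_period_ratio\<close>).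

  For \<open>k\<close> in the residue class of \<open>j + 1\<close> modulo \<open>t + 1\<close>, the numerator is one of the coefficients
  under the supremum and the denominator one of those under the infimum. The strict inequalities
  hold for finitely many \<open>i\<close>, so all these quotients are at most one constant \<open>q < 1\<close>
  (lemma \<open>uniform_ratio_of_SUP_less_INF\<close>). Hence \<open>x\<close> decays geometrically along this class. The next
  term \<open>x (k + 1)\<close> is at least \<open>A 1 k / x k\<close>, and \<open>A 1 k\<close> is bounded away from \<open>0\<close> because it is one
  of the coefficients under the infimum for \<open>i = t\<close>. So the terms \<open>x (k + 1)\<close> tend to infinity.
\<close>

lemma positive_solution_product_ge:
  assumes "positive_solution t A x" and "n \<ge> 1" and "i \<in> {1..t}"
  shows "A i (n - 1) \<le> x (int n) * x (int n - int i)"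
proof -
  have "A i (n - 1) / x (int n - int i) \<le> x (int n)"
    using assms by (auto simp: positive_solution_def)
  moreover have "x (int n - int i) > 0"
    using assms by (auto simp: positive_solution_def)
  ultimately show ?thesis by (simp add: field_simps)
qed

lemma positive_solution_product_eq:
  assumes "positive_solution t A x" and "t \<ge> 1" and "n \<ge> 1"
  obtains i where "i \<in> {1..t}" and "x (int n) * x (int n - int i) = A i (n - 1)"
proof -
  have "x (int n) \<in> (\<lambda>i. A i (n - 1) / x (int n - int i)) ` {1..t}"
    using assms Max_in[of "(\<lambda>i. A i (n - 1) / x (int n - int i)) ` {1..t}"]
    by (auto simp: positive_solution_def)
  then obtain i where i: "i \<in> {1..t}" "x (int n) = A i (n - 1) / x (int n - int i)"
    by auto
  moreover have "x (int n - int i) > 0"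
    using assms(1,3) i(1) by (auto simp: positive_solution_def)
  ultimately show ?thesis using that[of i] by simp
qed

text \<open>
  Both the equality at \<open>k + (t + 1)\<close> and the inequality \<open>i\<close> steps earlier contain the intermediate
  term \<open>x (k + (t + 1 - i))\<close>, which cancels.
\<close>

lemma positive_solution_period_ratio:
  assumes sol: "positive_solution t A x" and "t \<ge> 1" and "k \<ge> 1"
  obtains i where "i \<in> {1..t}"
    and "x (int (k + t + 1)) * A (t + 1 - i) (k + (t + 1 - i) - 1) \<le> A i (k + t) * x (int k)"
proof -
  obtain i where i: "i \<in> {1..t}"
    and eq: "x (int (k + t + 1)) * x (int (k + t + 1) - int i) = A i (k + t)"
    using positive_solution_product_eq[OF sol \<open>t \<ge> 1\<close>, of "k + t + 1"] by auto
  define l where "l = k + (t + 1 - i)"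
  have l: "int (k + t + 1) - int i = int l" "int l - int (t + 1 - i) = int k"
    using i by (auto simp: l_def)
  have ge: "A (t + 1 - i) (l - 1) \<le> x (int l) * x (int k)"
  proof -
    have "l \<ge> 1" "t + 1 - i \<in> {1..t}"
      using i \<open>k \<ge> 1\<close> by (auto simp: l_def)
    from positive_solution_product_ge[OF sol this] show ?thesis by (simp only: l(2))
  qed
  have "x (int (k + t + 1)) > 0"
    using sol by (simp add: positive_solution_def)
  then have "x (int (k + t + 1)) * A (t + 1 - i) (l - 1)
      \<le> x (int (k + t + 1)) * (x (int l) * x (int k))"
    using ge by (intro mult_left_mono) auto
  also have "\<dots> = A i (k + t) * x (int k)"
    using eq l(1) by simp
  finally show ?thesis using that[OF i] by (simp add: l_def)
qed

text \<open>
  Two separating reals rather than one, because it is their quotient \<open>a / b < 1\<close> that bounds all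
  the quotients \<open>f n / g n\<close> of positive terms at once.
\<close>

lemma SUP_less_INF_real_separation:
  fixes f g :: "nat \<Rightarrow> real"
  assumes "(SUP n. ereal (f n)) < (INF n. ereal (g n))"
  obtains a b :: real where "a < b" and "\<And>n. f n \<le> a" and "\<And>n. b \<le> g n"
proof -
  obtain a where a: "(SUP n. ereal (f n)) < ereal a" "ereal a < (INF n. ereal (g n))"
    using ereal_dense2[OF assms] by auto
  obtain b where b: "ereal a < ereal b" "ereal b < (INF n. ereal (g n))"
    using ereal_dense2[OF a(2)] by auto
  have "ereal (f n) \<le> ereal a" for n
    by (rule order_trans[OF SUP_upper less_imp_le[OF a(1)]]) simp
  moreover have "ereal b \<le> ereal (g n)" for n
    by (rule order_trans[OF less_imp_le[OF b(2)] INF_lower]) simp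
  ultimately show ?thesis using that b(1) by simp
qed

lemma uniform_ratio_of_SUP_less_INF:
  fixes f g :: "'i \<Rightarrow> nat \<Rightarrow> real"
  assumes "finite I" and "\<And>i n. i \<in> I \<Longrightarrow> f i n > 0"
    and "\<And>i. i \<in> I \<Longrightarrow> (SUP n. ereal (f i n)) < (INF n. ereal (g i n))"
  obtains q where "0 < q" and "q < 1" and "\<And>i n. i \<in> I \<Longrightarrow> f i n \<le> q * g i n"
proof -
  have "\<exists>q. 0 < q \<and> q < 1 \<and> (\<forall>n. f i n \<le> q * g i n)" if "i \<in> I" for i
  proof -
    obtain a b :: real where ab: "a < b" "\<And>n. f i n \<le> a" "\<And>n. b \<le> g i n"
      using SUP_less_INF_real_separation[OF assms(3)] \<open>i \<in> I\<close> by blast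
    have "a > 0" using assms(2)[OF that, of 0] ab(2)[of 0] by linarith
    have "f i n \<le> a / b * g i n" for n
    proof -
      have "a / b * b \<le> a / b * g i n"
        using ab \<open>a > 0\<close> by (intro mult_left_mono) auto
      then show ?thesis using ab(1) ab(2)[of n] \<open>a > 0\<close> by simp
    qed
    then show ?thesis using ab(1) \<open>a > 0\<close> by (intro exI[of _ "a / b"]) auto
  qed
  then obtain r where r: "\<And>i. i \<in> I \<Longrightarrow> 0 < r i \<and> r i < 1 \<and> (\<forall>n. f i n \<le> r i * g i n)"
    by metis
  \<comment> \<open>The extra element \<open>1 / 2\<close> keeps the maximum positive when \<open>I\<close> is empty.\<close>
  define q where "q = Max (insert (1 / 2) (r ` I))"
  have "q \<in> insert (1 / 2) (r ` I)"
    unfolding q_def using assms(1) by (intro Max_in) auto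
  then have "0 < q" "q < 1" using r by auto
  moreover have "f i n \<le> q * g i n" if "i \<in> I" for i n
  proof -
    have fg: "0 < r i" "f i n \<le> r i * g i n" using r[OF that] by auto
    then have "g i n > 0"
      using assms(2)[OF that, of n] by (meson less_le_trans zero_less_mult_pos)
    moreover have "r i \<le> q"
      unfolding q_def using assms(1) that by (intro Max_ge) auto
    ultimately have "r i * g i n \<le> q * g i n" by simp
    then show ?thesis using fg(2) by linarith
  qed
  ultimately show ?thesis by (rule that)
qed

theorem theorem10:
  fixes t j :: nat and A :: "nat \<Rightarrow> nat \<Rightarrow> real" and x :: "int \<Rightarrow> real"
  assumes "t \<ge> 1"
    and "\<And>i n. i \<in> {1..t} \<Longrightarrow> A i n > 0"
    and "j \<in> {1..t + 1}"
    and "\<And>i. i \<in> {1..t} \<Longrightarrow>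
           (SUP n::nat. ereal (A i ((t + 1) * n + (t + 1) + j)))
             < (INF n::nat. ereal (A (t + 1 - i) ((t + 1) * n + (t + 1 - i) + j)))"
    and "positive_solution t A x"
  shows "\<not> bounded_seq t x"
proof
  assume "bounded_seq t x"
  then obtain M where M: "M > 0" "\<And>n. n \<ge> - int t \<Longrightarrow> x n \<le> M"
    by (auto simp: bounded_seq_def)
  have pos: "x (int n) > 0" for n
    using assms(5) by (simp add: positive_solution_def)
  obtain q where q: "0 < q" "q < 1"
    and Aq: "\<And>i n. i \<in> {1..t} \<Longrightarrow> A i ((t + 1) * n + (t + 1) + j)
                 \<le> q * A (t + 1 - i) ((t + 1) * n + (t + 1 - i) + j)"
    using uniform_ratio_of_SUP_less_INF[of "{1..t}"
        "\<lambda>i n. A i ((t + 1) * n + (t + 1) + j)"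
        "\<lambda>i n. A (t + 1 - i) ((t + 1) * n + (t + 1 - i) + j)"] assms(2,4)
    by (metis finite_atLeastAtMost)
  define k where "k n = (t + 1) * n + j + 1" for n
  have decay: "x (int (k (Suc n))) \<le> q * x (int (k n))" for n
  proof -
    obtain i where i: "i \<in> {1..t}"
      and le: "x (int (k n + t + 1)) * A (t + 1 - i) (k n + (t + 1 - i) - 1)
                 \<le> A i (k n + t) * x (int (k n))"
      using positive_solution_period_ratio[OF assms(5,1), of "k n"] by (auto simp: k_def)
    define B where "B = A (t + 1 - i) (k n + (t + 1 - i) - 1)"
    have idx: "k n + t = (t + 1) * n + (t + 1) + j"
      "k n + (t + 1 - i) - 1 = (t + 1) * n + (t + 1 - i) + j"
      "k (Suc n) = k n + t + 1"
      by (auto simp: k_def)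
    have "B > 0" unfolding B_def using i by (intro assms(2)) auto
    have "x (int (k (Suc n))) * B \<le> A i (k n + t) * x (int (k n))"
      using le unfolding B_def idx(3) .
    also have "\<dots> \<le> (q * B) * x (int (k n))"
      using Aq[OF i, of n] pos[of "k n"] unfolding B_def idx(1,2)
      by (intro mult_right_mono) auto
    finally have "x (int (k (Suc n))) * B \<le> (q * x (int (k n))) * B"
      by (simp add: mult_ac)
    then show ?thesis using \<open>B > 0\<close> by simp
  qed
  have geometric: "x (int (k n)) \<le> q ^ n * M" for n
  proof (induction n)
    case 0
    show ?case using M(2)[of "int (k 0)"] by simp
  next
    case (Suc n)
    have "x (int (k (Suc n))) \<le> q * (q ^ n * M)"
      using decay[of n] mult_left_mono[OF Suc.IH, of q] q(1) by linarith
    then show ?case by (simp add: mult_ac)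
  qed
  \<comment> \<open>At \<open>i = t\<close> the coefficients under the infimum are the \<open>A 1 (k n)\<close>.\<close>
  obtain a b :: real where ab: "a < b"
    "\<And>n. A t ((t + 1) * n + (t + 1) + j) \<le> a"
    "\<And>n. b \<le> A (t + 1 - t) ((t + 1) * n + (t + 1 - t) + j)"
    using SUP_less_INF_real_separation[OF assms(4)[of t]] assms(1) by auto
  have "b > 0"
    using ab(1) ab(2)[of 0] assms(1) assms(2)[of t "(t + 1) * 0 + (t + 1) + j"] by auto
  have lower: "b \<le> M * x (int (k n))" for n
  proof -
    have "b \<le> A 1 (k n)"
      using ab(3)[of n] by (simp add: k_def)
    also have "\<dots> \<le> x (int (k n + 1)) * x (int (k n))"
      using positive_solution_product_ge[OF assms(5), of "k n + 1" 1] assms(1) by simp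
    also have "\<dots> \<le> M * x (int (k n))"
      using M(2)[of "int (k n + 1)"] pos[of "k n"] by (intro mult_right_mono) auto
    finally show ?thesis .
  qed
  obtain n where "q ^ n < b / (M * M)"
    using real_arch_pow_inv[of "b / (M * M)" q] q \<open>b > 0\<close> M(1) by auto
  then have "M * (q ^ n * M) < b"
    using M(1) by (simp add: field_simps)
  moreover have "M * x (int (k n)) \<le> M * (q ^ n * M)"
    using geometric[of n] M(1) by simp
  ultimately show False using lower[of n] by linarith
qed

end
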